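(* Let $C$ be a prefix-free machine. Then $\#S_C(n,s)\le 2^{n-H(n,s)+O(1)}$; that is, there exists $d\in\mathbb{N}$ such that $\#S_C(n,s)\le 2^{n-H(n,s)+d}$ for all $n\in\mathbb{N}$ and all $s\in\{0,1\}^*$.
   Context: $\{0,1\}^*$ is the set of finite binary strings (including the empty string $\lambda$), and $|p|$ is the length of a string $p$. $\mathbb{N}=\{0,1,2,\dots\}$. $\{0,1\}^*$ is ordered as $\lambda,0,1,00,01,10,11,000,\dots$ and identified with $\mathbb{N}$ in this order (that is, $s$ is identified with the natural number $1s-1$, where the concatenation $1s$ is read as a binary integer). $\#S$ is the cardinality of a set $S$, and $\operatorname{dom} f$ is the domain of definition of a (partial) function $f$. A subset of $\{0,1\}^*$ is prefix-free if no string in it is a prefix of another string in it. A prefix-free machine is a partial recursive function $C\colon\{0,1\}^*\to\{0,1\}^*$ such that $\operatorname{dom} C$ is a prefix-free set. For a prefix-free machine $C$ and $s\in\{0,1\}^*$, $H_C(s)=\min\{\,|p| \mid p\in\{0,1\}^*,\ C(p)=s\,\}$, with $H_C(s)=\infty$ if no such $p$ exists. A prefix-free machine $V$ is optimal if for each prefix-free machine $C$ there exists $d\in\mathbb{N}$ such that $H_V(s)\le H_C(s)+d$ for every $s\in\{0,1\}^*$. Throughout, a particular optimal prefix-free machine $U$ is fixed and $H(s)=H_U(s)$. A particular bijective total recursive function $b\colon\{0,1\}^*\times\{0,1\}^*\to\{0,1\}^*$ is fixed, and $H(s,t)=H(b(s,t))$; in $H(n,s)$ with $n\in\mathbb{N}$,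 $n$ is regarded as a string via the identification above. For a prefix-free machine $C$, $n\in\mathbb{N}$ and $s\in\{0,1\}^*$, $S_C(n,s)=\{\,p\in\{0,1\}^*\mid |p|\le n \text{ and } C(p)=s\,\}$. *)

theory Defs
  imports Complex_Main "HOL-Library.Sublist" "HOL-Library.Extended_Nat"
begin

text \<open>Kleene's partial recursive functions. A \<open>k\<close>-ary partial function is represented by a
  function on lists; only its values on lists of length \<open>k\<close> matter.\<close>

definition primitive_recursion ::
    "(nat list \<rightharpoonup> nat) \<Rightarrow> (nat list \<rightharpoonup> nat) \<Rightarrow> (nat list \<rightharpoonup> nat)" where
  "primitive_recursion f g xs =
     rec_nat (f (tl xs)) (\<lambda>m r. Option.bind r (\<lambda>y. g (m # y # tl xs))) (hd xs)"

definition minimization :: "(nat list \<rightharpoonup> nat) \<Rightarrow> (nat list \<rightharpoonup> nat)" where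
  "minimization f xs =
     (let P = (\<lambda>n. f (n # xs) = Some 0 \<and> (\<forall>m<n. \<exists>y. f (m # xs) = Some (Suc y)))
      in if \<exists>n. P n then Some (THE n. P n) else None)"

inductive partial_recursive :: "nat \<Rightarrow> (nat list \<rightharpoonup> nat) \<Rightarrow> bool" where
  pr_zero: "partial_recursive 0 (\<lambda>xs. Some 0)"
| pr_succ: "partial_recursive 1 (\<lambda>xs. Some (Suc (xs ! 0)))"
| pr_proj: "i < k \<Longrightarrow> partial_recursive k (\<lambda>xs. Some (xs ! i))"
| pr_comp: "\<lbrakk>partial_recursive (length gs) f; \<forall>g\<in>set gs. partial_recursive k g\<rbrakk>
    \<Longrightarrow> partial_recursive k (\<lambda>xs. Option.bind (those (map (\<lambda>g. g xs) gs)) f)"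
| pr_prim: "\<lbrakk>partial_recursive k f; partial_recursive (Suc (Suc k)) g\<rbrakk>
    \<Longrightarrow> partial_recursive (Suc k) (primitive_recursion f g)"
| pr_min: "partial_recursive (Suc k) f \<Longrightarrow> partial_recursive k (minimization f)"

text \<open>The string \<open>s\<close> is identified with \<open>1s - 1\<close>, where \<open>1s\<close> is read in binary with the most
  significant bit first, hence the \<open>rev\<close>.\<close>

type_synonym str = "bool list"

definition nat_of_str :: "str \<Rightarrow> nat" where
  "nat_of_str s = horner_sum of_bool 2 (rev (True # s)) - 1"

definition str_of_nat :: "nat \<Rightarrow> str" where
  "str_of_nat = inv nat_of_str"

lemma Suc_nat_of_str: "Suc (nat_of_str s) = horner_sum of_bool 2 (rev (True # s))"
proof -
  have "horner_sum of_bool 2 (rev (True # s)) > (0::nat)"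
    by (induction s rule: rev_induct) auto
  then show ?thesis
    by (simp add: nat_of_str_def)
qed

lemma nat_of_str_Nil [simp]: "nat_of_str [] = 0"
  by (simp add: nat_of_str_def)

lemma nat_of_str_snoc [simp]: "nat_of_str (s @ [c]) = 2 * nat_of_str s + 1 + of_bool c"
proof -
  have "Suc (nat_of_str (s @ [c])) = of_bool c + 2 * Suc (nat_of_str s)"
    unfolding Suc_nat_of_str by simp
  then show ?thesis by simp
qed

lemma bij_nat_of_str: "bij nat_of_str"
proof (rule bijI)
  have "nat_of_str s = nat_of_str t \<Longrightarrow> s = t" for s t
  proof (induction s arbitrary: t rule: rev_induct)
    case Nil
    then show ?case by (cases t rule: rev_cases) auto
  next
    case (snoc c s)
    then obtain c' t' where t: "t = t' @ [c']" by (cases t rule: rev_cases) auto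
    have eq: "2 * nat_of_str s + of_bool c = 2 * nat_of_str t' + of_bool c'"
      using snoc.prems t by simp
    then have "c = c'" by (cases c; cases c'; simp; presburger)
    with eq have "nat_of_str s = nat_of_str t'" by simp
    with snoc.IH \<open>c = c'\<close> t show ?case by simp
  qed
  then show "inj nat_of_str" by (rule injI)
next
  have "\<exists>s. nat_of_str s = n" for n
  proof (induction n rule: less_induct)
    case (less n)
    show ?case
    proof (cases "n = 0")
      case True
      then show ?thesis using nat_of_str_Nil by blast
    next
      case False
      then have "(n - 1) div 2 < n" by simp
      from less.IH[OF this] obtain s where s: "nat_of_str s = (n - 1) div 2" by blast
      have "nat_of_str (s @ [odd (n - 1)]) = n"
        using s False by (simp add: of_bool_def) presburger
      then show ?thesis by blast
    qed
  qed
  then show "surj nat_of_str" by (metis surjI)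
qed

definition partial_recursive_str :: "(str \<rightharpoonup> str) \<Rightarrow> bool" where
  "partial_recursive_str C \<longleftrightarrow>
     (\<exists>f. partial_recursive 1 f \<and> (\<forall>p. map_option nat_of_str (C p) = f [nat_of_str p]))"

definition total_recursive_str2 :: "(str \<times> str \<Rightarrow> str) \<Rightarrow> bool" where
  "total_recursive_str2 b \<longleftrightarrow>
     (\<exists>f. partial_recursive 2 f \<and>
       (\<forall>s t. f [nat_of_str s, nat_of_str t] = Some (nat_of_str (b (s, t)))))"

definition prefix_free :: "str set \<Rightarrow> bool" where
  "prefix_free S \<longleftrightarrow> (\<forall>p\<in>S. \<forall>q\<in>S. \<not> strict_prefix p q)"

definition prefix_free_machine :: "(str \<rightharpoonup> str) \<Rightarrow> bool" where
  "prefix_free_machine C \<longleftrightarrow> partial_recursive_str C \<and> prefix_free (dom C)"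

text \<open>The infimum over the empty set is \<open>\<infinity>\<close>.\<close>

definition complexity :: "(str \<rightharpoonup> str) \<Rightarrow> str \<Rightarrow> enat" where
  "complexity C s = (INF p\<in>{p. C p = Some s}. enat (length p))"

definition optimal :: "(str \<rightharpoonup> str) \<Rightarrow> bool" where
  "optimal V \<longleftrightarrow> prefix_free_machine V \<and>
     (\<forall>C. prefix_free_machine C \<longrightarrow>
       (\<exists>d::nat. \<forall>s. complexity V s \<le> complexity C s + enat d))"

definition joint_complexity ::
    "(str \<rightharpoonup> str) \<Rightarrow> (str \<times> str \<Rightarrow> str) \<Rightarrow> str \<Rightarrow> str \<Rightarrow> enat" where
  "joint_complexity U b s t = complexity U (b (s, t))"

definition programs :: "(str \<rightharpoonup> str) \<Rightarrow> nat \<Rightarrow> str \<Rightarrow> str set" where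
  "programs C n s = {p. length p \<le> n \<and> C p = Some s}"

lemma finite_programs: "finite (programs C n s)"
  by (rule finite_subset[OF _ finite_lists_length_le[of "UNIV :: bool set" n]])
     (auto simp: programs_def)

text \<open>Complexity with respect to an optimal machine is finite, so that \<open>the_enat\<close> loses nothing
  when it is applied to it.\<close>

lemma partial_recursive_const: "\<exists>f. partial_recursive 1 f \<and> (\<forall>x. f [x] = Some c)"
proof (induction c)
  case 0
  show ?case
    using pr_comp[of "[]" "\<lambda>xs. Some 0" 1] pr_zero by (auto intro!: exI)
next
  case (Suc c)
  then obtain f where f: "partial_recursive 1 f" "\<And>x. f [x] = Some c" by blast
  show ?case
    using pr_comp[of "[f]" "\<lambda>xs. Some (Suc (xs ! 0))" 1] f pr_succ by (auto intro!: exI)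
qed

lemma prefix_free_machine_singleton: "prefix_free_machine [[] \<mapsto> s]"
proof -
  let ?g = "minimization (\<lambda>xs. Some (xs ! 1))"
  obtain c where c: "partial_recursive 1 c" "\<And>x. c [x] = Some (nat_of_str s)"
    using partial_recursive_const by blast
  have g: "partial_recursive 1 ?g"
    by (rule pr_min) (simp add: pr_proj)
  have g0: "?g [0] = Some 0"
    by (auto simp: minimization_def Let_def)
  have g1: "?g [x] = None" if "x \<noteq> 0" for x
    using that by (auto simp: minimization_def Let_def)
  let ?f = "\<lambda>xs. Option.bind (those (map (\<lambda>g. g xs) [?g])) c"
  have "partial_recursive 1 ?f"
    by (rule pr_comp) (use c g in auto)
  moreover have "map_option nat_of_str ([[] \<mapsto> s] p) = ?f [nat_of_str p]" for p
  proof (cases "p = []")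
    case True
    have "?f [0] = Some (nat_of_str s)"
      using g0 c by (simp del: One_nat_def)
    then show ?thesis using True by simp
  next
    case False
    then have "nat_of_str p \<noteq> 0" by (cases p rule: rev_cases) auto
    then have "?f [nat_of_str p] = None"
      using g1 by (simp del: One_nat_def)
    then show ?thesis using False by simp
  qed
  ultimately show ?thesis
    unfolding prefix_free_machine_def partial_recursive_str_def
    by (auto simp: prefix_free_def)
qed

lemma complexity_optimal_finite:
  assumes "optimal V"
  shows "complexity V s \<noteq> \<infinity>"
proof -
  obtain d where "complexity V s \<le> complexity [[] \<mapsto> s] s + enat d"
    using assms prefix_free_machine_singleton unfolding optimal_def by blast
  moreover have "complexity [[] \<mapsto> s] s \<le> enat (length ([] :: str))"
    unfolding complexity_def by (rule INF_lower) simp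
  ultimately show ?thesis by (cases "complexity V s"; cases "complexity [[] \<mapsto> s] s") auto
qed

end

theory Submission
  imports Defs "HOL-Library.Nat_Bijection"
begin

text \<open>For each pair \<open>(n, s)\<close> and each \<open>k\<close> with \<open>2 ^ k \<le> #S\<^sub>C(n, s)\<close>, request a program of length
  \<open>n - k + 2\<close> for \<open>b (n, s)\<close>; such a request is recognised once enough programs of \<open>C\<close> have been
  seen to halt. The total weight of the requests is at most
  \<open>\<Sum>n s. 2 ^ -n * #S\<^sub>C(n, s) / 2 = \<Sum>p. 2 ^ -|p|\<close>, where \<open>p\<close> ranges over \<open>dom C\<close>, and this is at
  most 1 by Kraft's inequality for the prefix-free set \<open>dom C\<close>. Hence a prefix-free machine serves
  all requests with one extra bit, and optimality of \<open>U\<close>, applied with the largest \<open>k\<close>, gives the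
  bound. Running \<open>C\<close> for a bounded time is replaced by a total computable approximation of its
  graph, constructed by induction on partial recursive functions, so no universal machine is
  needed.\<close>

section \<open>Total computable functions\<close>

text \<open>Total functions keep \<open>Option.bind\<close> out of the closure proofs. Only lists of
  length \<open>k\<close> matter; elsewhere \<open>f\<close> and \<open>F\<close> are
  unrelated.\<close>

definition computable :: "nat \<Rightarrow> (nat list \<Rightarrow> nat) \<Rightarrow> bool" where
  "computable k F \<longleftrightarrow>
     (\<exists>f. partial_recursive k f \<and> (\<forall>xs. length xs = k \<longrightarrow> f xs = Some (F xs)))"

text \<open>The inner layer of a composition, kept as one list-valued function so that argument
  lists such as \<open>hd ys # tl (tl ys)\<close> can be assembled by rules for cons and
  \<open>tl\<close>.\<close>

definition computable_list :: "nat \<Rightarrow> nat \<Rightarrow> (nat list \<Rightarrow> nat list) \<Rightarrow> bool" where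
  "computable_list k n L \<longleftrightarrow>
     (\<exists>hs. length hs = n \<and> (\<forall>h\<in>set hs. computable k h) \<and>
       (\<forall>xs. length xs = k \<longrightarrow> L xs = map (\<lambda>h. h xs) hs))"

definition decidable :: "nat \<Rightarrow> (nat list \<Rightarrow> bool) \<Rightarrow> bool" where
  "decidable k P \<longleftrightarrow> computable k (\<lambda>xs. of_bool (P xs))"

lemma computable_cong:
  assumes "\<And>xs. length xs = k \<Longrightarrow> F xs = G xs"
  shows "computable k F \<longleftrightarrow> computable k G"
  using assms unfolding computable_def by auto

lemma those_map_Some: "those (map (\<lambda>h. Some (f h)) hs) = Some (map f hs)"
  by (induction hs) auto

lemma partial_recursive_comp_list:
  assumes f: "partial_recursive n f" and L: "computable_list k n L"
  shows "\<exists>f'. partial_recursive k f' \<and> (\<forall>xs. length xs = k \<longrightarrow> f' xs = f (L xs))"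
proof -
  obtain hs where hs: "length hs = n" "\<forall>h\<in>set hs. computable k h"
    "\<And>xs. length xs = k \<Longrightarrow> L xs = map (\<lambda>h. h xs) hs"
    using L unfolding computable_list_def by blast
  from hs(2) obtain c where c: "\<And>h. h \<in> set hs \<Longrightarrow> partial_recursive k (c h)"
    "\<And>h xs. h \<in> set hs \<Longrightarrow> length xs = k \<Longrightarrow> c h xs = Some (h xs)"
    unfolding computable_def by metis
  let ?f = "\<lambda>xs. Option.bind (those (map (\<lambda>g. g xs) (map c hs))) f"
  have "partial_recursive k ?f"
    by (rule pr_comp) (use f hs c in auto)
  moreover have "?f xs = f (L xs)" if "length xs = k" for xs
  proof -
    have "map (\<lambda>g. g xs) (map c hs) = map (\<lambda>h. Some (h xs)) hs"
      using c(2) that by auto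
    then show ?thesis
      using hs(3)[OF that] those_map_Some[of "\<lambda>h. h xs" hs] by (simp del: map_map)
  qed
  ultimately show ?thesis by blast
qed

lemma computable_comp_list:
  assumes "computable n F" "computable_list k n L"
  shows "computable k (\<lambda>xs. F (L xs))"
proof -
  obtain f where f: "partial_recursive n f" "\<And>xs. length xs = n \<Longrightarrow> f xs = Some (F xs)"
    using assms(1) unfolding computable_def by blast
  have "length (L xs) = n" if "length xs = k" for xs
    using assms(2) that unfolding computable_list_def by auto
  then show ?thesis
    using partial_recursive_comp_list[OF f(1) assms(2)] f(2) unfolding computable_def by metis
qed

lemma computable_proj: "i < k \<Longrightarrow> computable k (\<lambda>xs. xs ! i)"
  unfolding computable_def using pr_proj by blast

lemma computable_list_nil: "computable_list k 0 (\<lambda>xs. [])"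
  unfolding computable_list_def by simp

lemma computable_list_cons:
  assumes "computable k h" "computable_list k n L"
  shows "computable_list k (Suc n) (\<lambda>xs. h xs # L xs)"
proof -
  obtain hs where "length hs = n" "\<forall>h\<in>set hs. computable k h"
    "\<And>xs. length xs = k \<Longrightarrow> L xs = map (\<lambda>h. h xs) hs"
    using assms(2) unfolding computable_list_def by blast
  then show ?thesis
    using assms(1) unfolding computable_list_def by (intro exI[of _ "h # hs"]) simp
qed

lemma computable_list_tl:
  assumes "computable_list k (Suc n) L"
  shows "computable_list k n (\<lambda>xs. tl (L xs))"
proof -
  obtain hs where "length hs = Suc n" "\<forall>h\<in>set hs. computable k h"
    "\<And>xs. length xs = k \<Longrightarrow> L xs = map (\<lambda>h. h xs) hs"
    using assms unfolding computable_list_def by blast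
  then show ?thesis
    unfolding computable_list_def
    by (intro exI[of _ "tl hs"]) (auto simp: map_tl dest: list.set_sel(2)[rotated])
qed

lemma computable_list_id: "computable_list k k (\<lambda>xs. xs)"
  unfolding computable_list_def
  by (rule exI[of _ "map (\<lambda>i xs. xs ! i) [0..<k]"])
     (auto simp: computable_proj intro: nth_equalityI)

lemma computable_nth:
  assumes "computable_list k n L" "i < n"
  shows "computable k (\<lambda>xs. L xs ! i)"
  using computable_comp_list[OF computable_proj[OF assms(2)] assms(1)] .

lemma computable_hd:
  assumes "computable_list k (Suc n) L"
  shows "computable k (\<lambda>xs. hd (L xs))"
proof -
  have "computable k (\<lambda>xs. L xs ! 0)"
    by (rule computable_nth[OF assms]) simp
  moreover have "L xs ! 0 = hd (L xs)" if "length xs = k" for xs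
    using assms that unfolding computable_list_def by (cases "L xs") auto
  ultimately show ?thesis
    using computable_cong by (metis (no_types, lifting))
qed

lemma computable_Suc:
  assumes "computable k F"
  shows "computable k (\<lambda>xs. Suc (F xs))"
proof -
  have "computable 1 (\<lambda>xs. Suc (xs ! 0))"
    unfolding computable_def using pr_succ by blast
  moreover have "computable_list k 1 (\<lambda>xs. [F xs])"
    using computable_list_cons[OF assms computable_list_nil] by simp
  ultimately show ?thesis
    using computable_comp_list by fastforce
qed

lemma computable_const: "computable k (\<lambda>xs. c)"
proof (induction c)
  case 0
  have "computable 0 (\<lambda>xs. 0)"
    unfolding computable_def using pr_zero by blast
  then show ?case
    using computable_comp_list[OF _ computable_list_nil] by blast
next
  case (Suc c)
  then show ?case by (rule computable_Suc)
qed

text \<open>\<open>pr_prim\<close> recurses on the first argument; substituting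
  \<open>N xs # xs\<close> turns this into recursion up to a computed bound. The step reads index,
  previous value and parameters off one list, hence \<open>hd\<close> and \<open>tl\<close>.\<close>

lemma computable_rec_nat:
  assumes "computable k A"
    and "computable (Suc (Suc k)) (\<lambda>ys. S (hd ys) (hd (tl ys)) (tl (tl ys)))"
    and "computable k N"
  shows "computable k (\<lambda>xs. rec_nat (A xs) (\<lambda>m r. S m r xs) (N xs))"
proof -
  obtain f where f: "partial_recursive k f" "\<And>xs. length xs = k \<Longrightarrow> f xs = Some (A xs)"
    using assms(1) unfolding computable_def by blast
  obtain g where g: "partial_recursive (Suc (Suc k)) g"
    "\<And>ys. length ys = Suc (Suc k) \<Longrightarrow> g ys = Some (S (hd ys) (hd (tl ys)) (tl (tl ys)))"
    using assms(2) unfolding computable_def by blast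
  have "primitive_recursion f g (n # xs) = Some (rec_nat (A xs) (\<lambda>m r. S m r xs) n)"
    if "length xs = k" for n xs
    unfolding primitive_recursion_def by (induction n) (use f g that in auto)
  then have "\<forall>ys. length ys = Suc k \<longrightarrow> primitive_recursion f g ys =
      Some (rec_nat (A (tl ys)) (\<lambda>m r. S m r (tl ys)) (hd ys))"
    by (metis diff_Suc_1 length_tl list.collapse list.size(3) nat.distinct(1))
  then have "computable (Suc k) (\<lambda>ys. rec_nat (A (tl ys)) (\<lambda>m r. S m r (tl ys)) (hd ys))"
    unfolding computable_def using pr_prim[OF f(1) g(1)] by blast
  from computable_comp_list[OF this computable_list_cons[OF assms(3) computable_list_id]]
  show ?thesis by simp
qed

section \<open>Closure under arithmetic, bounded sums, bounded quantifiers and pairing\<close>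

named_theorems computable_intros

lemmas [computable_intros] = computable_hd computable_nth computable_list_tl computable_list_id
  computable_list_cons computable_list_nil computable_Suc computable_const

lemma computable_add [computable_intros]:
  assumes "computable k F" "computable k G"
  shows "computable k (\<lambda>xs. F xs + G xs)"
proof -
  have "computable k (\<lambda>xs. rec_nat (F xs) (\<lambda>m r. Suc r) (G xs))"
    by (rule computable_rec_nat) (rule computable_intros assms)+
  moreover have "rec_nat a (\<lambda>m r. Suc r) b = a + b" for a b :: nat
    by (induction b) auto
  ultimately show ?thesis by simp
qed

lemma computable_mult [computable_intros]:
  assumes "computable k F" "computable k G"
  shows "computable k (\<lambda>xs. F xs * G xs)"
proof -
  have F: "computable (Suc (Suc k)) (\<lambda>ys. F (tl (tl ys)))"
    by (rule computable_comp_list[OF assms(1)]) (rule computable_intros)+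
  have "computable k (\<lambda>xs. rec_nat 0 (\<lambda>m r. r + F xs) (G xs))"
    by (rule computable_rec_nat) (rule computable_intros assms F)+
  moreover have "rec_nat 0 (\<lambda>m r. r + a) b = a * b" for a b :: nat
    by (induction b) auto
  ultimately show ?thesis by simp
qed

lemma computable_power [computable_intros]:
  assumes "computable k F" "computable k G"
  shows "computable k (\<lambda>xs. F xs ^ G xs)"
proof -
  have F: "computable (Suc (Suc k)) (\<lambda>ys. F (tl (tl ys)))"
    by (rule computable_comp_list[OF assms(1)]) (rule computable_intros)+
  have "computable k (\<lambda>xs. rec_nat 1 (\<lambda>m r. F xs * r) (G xs))"
    by (rule computable_rec_nat) (rule computable_intros assms F)+
  moreover have "rec_nat 1 (\<lambda>m r. a * r) b = a ^ b" for a b :: nat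
    by (induction b) auto
  ultimately show ?thesis by simp
qed

lemma computable_sum [computable_intros]:
  assumes "computable (Suc k) (\<lambda>ys. G (hd ys) (tl ys))" "computable k N"
  shows "computable k (\<lambda>xs. \<Sum>i<N xs. G i xs)"
proof -
  have "computable (Suc (Suc k)) (\<lambda>ys. (\<lambda>zs. G (hd zs) (tl zs)) (hd ys # tl (tl ys)))"
    by (rule computable_comp_list[OF assms(1)]) (rule computable_intros)+
  then have G: "computable (Suc (Suc k)) (\<lambda>ys. G (hd ys) (tl (tl ys)))"
    by simp
  have "computable k (\<lambda>xs. rec_nat 0 (\<lambda>m r. r + G m xs) (N xs))"
    by (rule computable_rec_nat) (rule computable_intros assms G)+
  moreover have "rec_nat 0 (\<lambda>m r. r + g m) b = (\<Sum>i<b. g i)" for g :: "nat \<Rightarrow> nat" and b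
    by (induction b) auto
  ultimately show ?thesis by simp
qed

lemma computable_diff [computable_intros]:
  assumes "computable k F" "computable k G"
  shows "computable k (\<lambda>xs. F xs - G xs)"
proof -
  \<comment> \<open>The predecessor is the recursion that returns its index; iterating it gives
    truncated subtraction.\<close>
  have "computable 1 (\<lambda>xs. rec_nat 0 (\<lambda>m r. m) (xs ! 0))"
    by (rule computable_rec_nat; rule computable_intros) (simp | rule computable_intros)+
  moreover have rec0: "rec_nat 0 (\<lambda>m r. m) n = n - 1" for n :: nat
    by (cases n) auto
  ultimately have "computable 1 (\<lambda>xs. xs ! 0 - 1)"
    by (simp only: rec0)
  then have pred: "computable j (\<lambda>xs. H xs - 1)" if "computable j H" for j H
    using computable_comp_list[OF _ computable_list_cons[OF that computable_list_nil], of "\<lambda>xs. xs ! 0 - 1"]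
    by simp
  have "computable k (\<lambda>xs. rec_nat (F xs) (\<lambda>m r. r - 1) (G xs))"
    by (rule computable_rec_nat) (rule computable_intros assms pred)+
  moreover have "rec_nat a (\<lambda>m r. r - 1) b = a - b" for a b :: nat
    by (induction b) auto
  ultimately show ?thesis by simp
qed

lemma computable_of_bool [computable_intros]:
  "decidable k P \<Longrightarrow> computable k (\<lambda>xs. of_bool (P xs))"
  by (simp add: decidable_def)

lemma decidable_not [computable_intros]:
  assumes "decidable k P"
  shows "decidable k (\<lambda>xs. \<not> P xs)"
proof -
  have "computable k (\<lambda>xs. 1 - of_bool (P xs))"
    by (rule computable_intros assms)+
  then show ?thesis
    unfolding decidable_def by (rule iffD1[OF computable_cong, rotated]) simp
qed

lemma decidable_conj [computable_intros]:
  assumes "decidable k P" "decidable k Q"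
  shows "decidable k (\<lambda>xs. P xs \<and> Q xs)"
proof -
  have "computable k (\<lambda>xs. of_bool (P xs) * of_bool (Q xs))"
    by (rule computable_intros assms)+
  then show ?thesis
    unfolding decidable_def by (simp add: of_bool_conj)
qed

lemma decidable_le [computable_intros]:
  assumes "computable k F" "computable k G"
  shows "decidable k (\<lambda>xs. F xs \<le> G xs)"
proof -
  have "computable k (\<lambda>xs. 1 - (F xs - G xs))"
    by (rule computable_intros assms)+
  then show ?thesis
    unfolding decidable_def by (rule iffD1[OF computable_cong, rotated]) auto
qed

lemma decidable_less [computable_intros]:
  assumes "computable k F" "computable k G"
  shows "decidable k (\<lambda>xs. F xs < G xs)"
  using decidable_le[OF computable_Suc[OF assms(1)] assms(2)] by (simp add: Suc_le_eq)

lemma decidable_eq [computable_intros]: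
  assumes "computable k F" "computable k G"
  shows "decidable k (\<lambda>xs. F xs = G xs)"
  using decidable_conj[OF decidable_le[OF assms] decidable_le[OF assms(2,1)]]
  by (simp add: eq_iff)

lemma decidable_ex_less [computable_intros]:
  assumes "decidable (Suc k) (\<lambda>ys. P (hd ys) (tl ys))" "computable k N"
  shows "decidable k (\<lambda>xs. \<exists>i<N xs. P i xs)"
proof -
  have "decidable k (\<lambda>xs. 0 < (\<Sum>i<N xs. of_bool (P i xs) :: nat))"
    by (rule computable_intros assms)+
  moreover have "0 < (\<Sum>i<n. of_bool (Q i) :: nat) \<longleftrightarrow> (\<exists>i<n. Q i)" for Q and n :: nat
    by (induction n) (auto simp: less_Suc_eq)
  ultimately show ?thesis by simp
qed

lemma decidable_all_less [computable_intros]: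
  assumes "decidable (Suc k) (\<lambda>ys. P (hd ys) (tl ys))" "computable k N"
  shows "decidable k (\<lambda>xs. \<forall>i<N xs. P i xs)"
proof -
  have "decidable k (\<lambda>xs. \<not> (\<exists>i<N xs. \<not> P i xs))"
    by (rule computable_intros assms)+
  then show ?thesis by simp
qed

text \<open>The quotient counts the positive multiples of the divisor that do not exceed the
  dividend. The guard \<open>0 < G xs\<close> yields the value 0 for division by zero.\<close>

lemma computable_div [computable_intros]:
  assumes "computable k F" "computable k G"
  shows "computable k (\<lambda>xs. F xs div G xs)"
proof -
  have F: "computable (Suc k) (\<lambda>ys. F (tl ys))" and G: "computable (Suc k) (\<lambda>ys. G (tl ys))"
    by (rule computable_comp_list[OF assms(1)] computable_comp_list[OF assms(2)];
        (rule computable_intros)+)+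
  have "computable k (\<lambda>xs. \<Sum>q<F xs. of_bool (0 < G xs \<and> Suc q * G xs \<le> F xs))"
    by (rule computable_intros assms F G)+
  moreover have "(\<Sum>q<a. of_bool (0 < b \<and> Suc q * b \<le> a)) = a div b" for a b :: nat
  proof (cases "b = 0")
    case False
    then have "Suc q * b \<le> a \<longleftrightarrow> q < a div b" for q
      by (simp add: less_eq_div_iff_mult_less_eq flip: Suc_le_eq)
    moreover have "{q. q < a \<and> q < a div b} = {..<a div b}"
      using div_le_dividend[of a b] by (auto intro: less_le_trans)
    ultimately show ?thesis
      using False by (simp add: sum.If_cases of_bool_def lessThan_def Int_def)
  qed simp
  ultimately show ?thesis by simp
qed

lemma computable_triangle [computable_intros]:
  assumes "computable k F"
  shows "computable k (\<lambda>xs. triangle (F xs))"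
  unfolding triangle_def by (rule computable_intros assms)+

lemma computable_prod_encode [computable_intros]:
  assumes "computable k F" "computable k G"
  shows "computable k (\<lambda>xs. prod_encode (F xs, G xs))"
  unfolding prod_encode_def by (simp, (rule computable_intros assms)+)

text \<open>Both components of a pair are bounded by its code, so a bounded search finds them; the
  sum selects exactly one index, the component itself.\<close>

lemma computable_fst_prod_decode [computable_intros]:
  assumes "computable k F"
  shows "computable k (\<lambda>xs. fst (prod_decode (F xs)))"
proof -
  have "computable 1 (\<lambda>xs. \<Sum>m<Suc (xs ! 0). m * of_bool (\<exists>n<Suc (xs ! 0). prod_encode (m, n) = xs ! 0))"
    by (rule computable_intros | simp)+
  moreover have "(\<Sum>m<Suc x. m * of_bool (\<exists>n<Suc x. prod_encode (m, n) = x)) = fst (prod_decode x)" for x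
  proof -
    obtain a b where ab: "x = prod_encode (a, b)"
      by (metis prod_decode_inverse surj_pair)
    have "(\<exists>n<Suc x. prod_encode (m, n) = x) \<longleftrightarrow> m = a" for m
      using le_prod_encode_2[of b a] ab by (auto simp: less_Suc_eq_le prod_encode_eq)
    moreover have "a < Suc x"
      using le_prod_encode_1[of a b] ab by simp
    ultimately show ?thesis
      using ab by (simp add: of_bool_def if_distrib sum.delta cong: if_cong)
  qed
  ultimately have "computable 1 (\<lambda>xs. fst (prod_decode (xs ! 0)))" by simp
  from computable_comp_list[OF this[unfolded One_nat_def] computable_list_cons[OF assms computable_list_nil]]
  show ?thesis by simp
qed

lemma computable_snd_prod_decode [computable_intros]:
  assumes "computable k F"
  shows "computable k (\<lambda>xs. snd (prod_decode (F xs)))"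
proof -
  have F: "computable (Suc k) (\<lambda>ys. F (tl ys))"
    by (rule computable_comp_list[OF assms], (rule computable_intros)+)
  have "computable k (\<lambda>xs. \<Sum>n<Suc (F xs). n * of_bool (prod_encode (fst (prod_decode (F xs)), n) = F xs))"
    by (rule computable_intros assms F)+
  moreover have "(\<Sum>n<Suc x. n * of_bool (prod_encode (fst (prod_decode x), n) = x)) = snd (prod_decode x)" for x
  proof -
    obtain a b where ab: "x = prod_encode (a, b)"
      by (metis prod_decode_inverse surj_pair)
    moreover have "b < Suc x"
      using le_prod_encode_2[of b a] ab by simp
    ultimately show ?thesis
      by (simp add: prod_encode_eq of_bool_def if_distrib sum.delta cong: if_cong)
  qed
  ultimately show ?thesis by simp
qed

section \<open>Approximation in stages\<close>

text \<open>In \<open>g (t # xs)\<close> the value \<open>0\<close> means that no result is known at stage \<open>t\<close>, and \<open>Suc y\<close>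
  that the result is \<open>y\<close>.\<close>

definition stagewise :: "nat \<Rightarrow> (nat list \<rightharpoonup> nat) \<Rightarrow> (nat list \<Rightarrow> nat) \<Rightarrow> bool" where
  "stagewise k f g \<longleftrightarrow> computable (Suc k) g \<and> (\<forall>xs. length xs = k \<longrightarrow>
     (\<forall>t y. g (t # xs) = Suc y \<longrightarrow> f xs = Some y) \<and>
     (\<forall>y. f xs = Some y \<longrightarrow> (\<forall>\<^sub>F t in sequentially. g (t # xs) = Suc y)))"

lemma stagewiseD:
  assumes "stagewise k f g" "length xs = k"
  shows "g (t # xs) = Suc y \<Longrightarrow> f xs = Some y"
    and "f xs = Some y \<Longrightarrow> \<forall>\<^sub>F t in sequentially. g (t # xs) = Suc y"
  using assms unfolding stagewise_def by auto

lemma computable_list_map: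
  assumes "\<And>g. g \<in> set gs \<Longrightarrow> computable k (h g)"
  shows "computable_list k (length gs) (\<lambda>xs. map (\<lambda>g. h g xs) gs)"
  using assms unfolding computable_list_def by (intro exI[of _ "map h gs"]) auto

lemma decidable_ball_set:
  assumes "\<And>g. g \<in> set gs \<Longrightarrow> decidable k (P g)"
  shows "decidable k (\<lambda>xs. \<forall>g\<in>set gs. P g xs)"
  using assms
proof (induction gs)
  case Nil
  then show ?case by (simp add: decidable_def computable_const[of _ 1, simplified])
next
  case (Cons g gs)
  then show ?case by (auto intro: decidable_conj)
qed

lemma those_eq_Some: "those ys = Some vs \<longleftrightarrow> ys = map Some vs"
proof (induction ys arbitrary: vs)
  case (Cons y ys)
  then show ?case by (cases vs) (auto split: option.splits)
qed auto

text \<open>All functions are evaluated at the same stage. The result is \<open>0\<close> while some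
  inner value is unknown; once the finitely many inner values have settled, the outer approximation
  sees fixed arguments and settles too.\<close>

lemma stagewise_comp:
  assumes F: "stagewise (length gs) f F"
    and h: "\<And>g. g \<in> set gs \<Longrightarrow> stagewise k g (h g)"
  shows "stagewise k (\<lambda>xs. Option.bind (those (map (\<lambda>g. g xs) gs)) f)
    (\<lambda>ys. of_bool (\<forall>g\<in>set gs. 0 < h g ys) * F (hd ys # map (\<lambda>g. h g ys - 1) gs))"
  (is "stagewise k ?f ?G")
  unfolding stagewise_def
proof (intro conjI allI impI)
  have hc: "computable (Suc k) (h g)" if "g \<in> set gs" for g
    using h that unfolding stagewise_def by blast
  have Fc: "computable (Suc (length gs)) F"
    using F unfolding stagewise_def by blast
  have "computable_list (Suc k) (length gs) (\<lambda>ys. map (\<lambda>g. h g ys - 1) gs)"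
    by (rule computable_list_map) (rule computable_intros hc | assumption)+
  then have "computable (Suc k) (\<lambda>ys. F (hd ys # map (\<lambda>g. h g ys - 1) gs))"
    by (intro computable_comp_list[OF Fc]) (rule computable_intros | assumption)+
  moreover have "decidable (Suc k) (\<lambda>ys. \<forall>g\<in>set gs. 0 < h g ys)"
    by (rule decidable_ball_set) (rule computable_intros hc | assumption)+
  ultimately show "computable (Suc k) ?G"
    by (intro computable_intros)
next
  fix xs t y
  assume xs: "length xs = k" and G: "?G (t # xs) = Suc y"
  have pos: "\<forall>g\<in>set gs. 0 < h g (t # xs)"
    using G by (rule contrapos_pp) (auto simp: of_bool_def)
  have "g xs = Some (h g (t # xs) - 1)" if "g \<in> set gs" for g
    using pos that stagewiseD(1)[OF h[OF that] xs, of t "h g (t # xs) - 1"] by auto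
  then have "map (\<lambda>g. g xs) gs = map Some (map (\<lambda>g. h g (t # xs) - 1) gs)"
    by simp
  then have "those (map (\<lambda>g. g xs) gs) = Some (map (\<lambda>g. h g (t # xs) - 1) gs)"
    unfolding those_eq_Some .
  moreover have "f (map (\<lambda>g. h g (t # xs) - 1) gs) = Some y"
    by (rule stagewiseD(1)[OF F, of _ t]) (use G pos in auto)
  ultimately show "?f xs = Some y"
    by simp
next
  fix xs y
  assume xs: "length xs = k" and fy: "?f xs = Some y"
  then obtain vs where vs: "map (\<lambda>g. g xs) gs = map Some vs" "f vs = Some y"
    by (auto simp: bind_eq_Some_conv those_eq_Some)
  then have len: "length vs = length gs"
    by (metis length_map)
  have the: "vs = map (\<lambda>g. the (g xs)) gs"
    using arg_cong[OF vs(1), of "map the"] by (simp add: comp_def)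
  have Some: "g xs = Some (the (g xs))" if "g \<in> set gs" for g
    using vs(1) that by (metis (no_types, lifting) image_eqI image_iff list.set_map option.sel)
  have "\<forall>\<^sub>F t in sequentially. \<forall>g\<in>set gs. h g (t # xs) = Suc (the (g xs))"
    by (intro eventually_ball_finite ballI stagewiseD(2)[OF h xs] Some) auto
  moreover have "\<forall>\<^sub>F t in sequentially. F (t # vs) = Suc y"
    by (rule stagewiseD(2)[OF F len vs(2)])
  ultimately show "\<forall>\<^sub>F t in sequentially. ?G (t # xs) = Suc y"
  proof eventually_elim
    case (elim t)
    then have "map (\<lambda>g. h g (t # xs) - 1) gs = vs"
      unfolding the by simp
    with elim show ?case by simp
  qed
qed

text \<open>Every level of the recursion uses the same stage, and \<open>of_bool (0 < r)\<close>
  passes an unknown value upwards. Both properties follow by induction on the recursion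
  argument.\<close>

lemma stagewise_prim:
  assumes F: "stagewise k f F" and G: "stagewise (Suc (Suc k)) g G"
  shows "stagewise (Suc k) (primitive_recursion f g)
    (\<lambda>ys. rec_nat (F (hd ys # tl (tl ys)))
      (\<lambda>m r. of_bool (0 < r) * G (hd ys # m # (r - 1) # tl (tl ys))) (hd (tl ys)))"
  (is "stagewise _ _ ?R")
proof -
  have Fc: "computable (Suc k) F" and Gc: "computable (Suc (Suc (Suc k))) G"
    using F G unfolding stagewise_def by auto
  have comp: "computable (Suc (Suc k)) ?R"
    by (rule computable_rec_nat computable_comp_list[OF Fc] computable_comp_list[OF Gc] computable_mult
        computable_of_bool decidable_less computable_hd computable_list_tl computable_list_id
        computable_list_cons computable_diff computable_const)+
  have sound: "primitive_recursion f g (n # xs) = Some y"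
    if "length xs = k" "?R (t # n # xs) = Suc y" for t n y xs
    using that(2)
  proof (induction n arbitrary: y)
    case 0
    then show ?case
      using stagewiseD(1)[OF F that(1)] by (simp add: primitive_recursion_def)
  next
    case (Suc n)
    let ?r = "?R (t # n # xs)"
    have "?r > 0"
      using Suc.prems by (rule contrapos_pp) simp
    then obtain z where z: "?r = Suc z"
      by (cases ?r) auto
    with Suc.prems have "G (t # n # z # xs) = Suc y"
      by simp
    then have "g (n # z # xs) = Some y"
      using stagewiseD(1)[OF G] that(1) by simp
    with Suc.IH[OF z] show ?case
      by (simp add: primitive_recursion_def)
  qed
  have complete: "\<forall>\<^sub>F t in sequentially. ?R (t # n # xs) = Suc y"
    if "length xs = k" "primitive_recursion f g (n # xs) = Some y" for n y xs
    using that(2)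
  proof (induction n arbitrary: y)
    case 0
    then show ?case
      using stagewiseD(2)[OF F that(1)] by (simp add: primitive_recursion_def)
  next
    case (Suc n)
    then obtain z where z: "primitive_recursion f g (n # xs) = Some z" "g (n # z # xs) = Some y"
      by (auto simp: primitive_recursion_def bind_eq_Some_conv)
    have "\<forall>\<^sub>F t in sequentially. G (t # n # z # xs) = Suc y"
      using stagewiseD(2)[OF G _ z(2)] that(1) by simp
    with Suc.IH[OF z(1)] show ?case
      by eventually_elim simp
  qed
  show ?thesis
    unfolding stagewise_def length_Suc_conv using comp sound complete by blast
qed

text \<open>Two witnesses would conflict at the smaller one, so \<open>THE\<close> selects the only
  candidate.\<close>

lemma minimization_eq_Some:
  "minimization f xs = Some n \<longleftrightarrow>
     f (n # xs) = Some 0 \<and> (\<forall>m<n. \<exists>y. f (m # xs) = Some (Suc y))"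
proof -
  define P where "P = (\<lambda>n. f (n # xs) = Some 0 \<and> (\<forall>m<n. \<exists>y. f (m # xs) = Some (Suc y)))"
  have uniq: "a = b" if "P a" "P b" for a b
    using that unfolding P_def by (cases a b rule: linorder_cases) auto
  then have the: "The P = a" if "P a" for a
    using that by blast
  have "minimization f xs = (if \<exists>n. P n then Some (The P) else None)"
    unfolding minimization_def Let_def P_def ..
  also have "\<dots> = Some n \<longleftrightarrow> P n"
    using the by auto
  finally show ?thesis
    unfolding P_def .
qed

text \<open>The search is cut off at the stage. As \<open>F\<close> shifts values by one,
  \<open>= 1\<close> means a known zero and \<open>1 <\<close> a known positive value; at most one
  \<open>n\<close> passes the test, so the sum is \<open>Suc n\<close> or \<open>0\<close>.\<close>

lemma stagewise_min:
  assumes F: "stagewise (Suc k) f F"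
  shows "stagewise k (minimization f)
    (\<lambda>ys. \<Sum>n<hd ys. Suc n * of_bool (F (hd ys # n # tl ys) = 1 \<and>
       (\<forall>m<n. 1 < F (hd ys # m # tl ys))))"
  (is "stagewise _ _ ?M")
  unfolding stagewise_def
proof (intro conjI allI impI)
  have Fc: "computable (Suc (Suc k)) F"
    using F unfolding stagewise_def by auto
  show "computable (Suc k) ?M"
    by (rule computable_sum computable_mult computable_Suc computable_of_bool decidable_conj
       decidable_eq decidable_less decidable_all_less computable_comp_list[OF Fc]
       computable_hd computable_list_tl computable_list_id
        computable_list_cons computable_const)+
next
  fix xs t y
  assume xs: "length xs = k" and M: "?M (t # xs) = Suc y"
  let ?P = "\<lambda>n. F (t # n # xs) = 1 \<and> (\<forall>m<n. 1 < F (t # m # xs))"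
  have D: "F (t # m # xs) = Suc z \<Longrightarrow> f (m # xs) = Some z" for m z
    using stagewiseD(1)[OF F] xs by simp
  have min: "minimization f xs = Some n" if "?P n" for n
    unfolding minimization_eq_Some
  proof (intro conjI allI impI)
    show "f (n # xs) = Some 0"
      using that D by simp
  next
    fix m assume "m < n"
    then have "F (t # m # xs) = Suc (Suc (F (t # m # xs) - 2))"
      using that by auto
    then show "\<exists>y. f (m # xs) = Some (Suc y)"
      using D by blast
  qed
  have "\<exists>n<t. ?P n"
  proof (rule ccontr)
    assume "\<not> (\<exists>n<t. ?P n)"
    then have "?M (t # xs) = 0"
      unfolding list.sel by (intro sum.neutral) auto
    with M show False by simp
  qed
  then obtain n where n: "n < t" "?P n" by blast
  \<comment> \<open>Both candidates equal the value of \<open>minimization f xs\<close>.\<close>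
  have "?P m \<longleftrightarrow> m = n" for m
    using min[of m] min[OF n(2)] n(2) by auto
  then have "?M (t # xs) = (\<Sum>m<t. Suc m * of_bool (m = n))"
    by simp
  also have "\<dots> = Suc n"
    using n(1) by (simp add: of_bool_def if_distrib sum.delta cong: if_cong)
  finally show "minimization f xs = Some y"
    using M min[OF n(2)] by simp
next
  fix xs n
  assume xs: "length xs = k" and "minimization f xs = Some n"
  then have n: "f (n # xs) = Some 0" "\<forall>m<n. \<exists>y. f (m # xs) = Some (Suc y)"
    unfolding minimization_eq_Some by auto
  have "\<forall>\<^sub>F t in sequentially. F (t # n # xs) = 1"
    using stagewiseD(2)[OF F _ n(1)] xs by simp
  moreover have "\<forall>\<^sub>F t in sequentially. 1 < F (t # m # xs)" if m: "m < n" for m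
  proof -
    obtain y where "f (m # xs) = Some (Suc y)"
      using n(2) m by blast
    then have "\<forall>\<^sub>F t in sequentially. F (t # m # xs) = Suc (Suc y)"
      using stagewiseD(2)[OF F] xs by simp
    then show ?thesis
      by eventually_elim simp
  qed
  then have "\<forall>\<^sub>F t in sequentially. \<forall>m\<in>{..<n}. 1 < F (t # m # xs)"
    by (intro eventually_ball_finite) auto
  \<comment> \<open>The stage must also exceed \<open>n\<close>, so that the cut-off search reaches
    it.\<close>
  ultimately show "\<forall>\<^sub>F t in sequentially. ?M (t # xs) = Suc n"
    using eventually_gt_at_top[of n]
  proof eventually_elim
    case (elim t)
    have "F (t # m # xs) = 1 \<and> (\<forall>i<m. 1 < F (t # i # xs)) \<longleftrightarrow> m = n" for m
    proof -
      have "F (t # m # xs) \<noteq> 1" if "m < n"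
        using elim that by force
      moreover have "\<not> (\<forall>i<m. 1 < F (t # i # xs))" if "n < m"
        using elim that by force
      moreover have "\<forall>i<n. 1 < F (t # i # xs)"
        using elim by blast
      ultimately show ?thesis
        using elim(1) by (metis linorder_neqE_nat)
    qed
    then have "?M (t # xs) = (\<Sum>m<t. Suc m * of_bool (m = n))"
      by simp
    also have "\<dots> = Suc n"
      using elim by (simp add: of_bool_def if_distrib sum.delta cong: if_cong)
    finally show ?case .
  qed
qed

text \<open>Induction on the construction of \<open>f\<close>; the initial functions are known at
  every stage. This supplies the enumeration of the graph that is usually obtained by counting
  computation steps.\<close>

lemma partial_recursive_stagewise:
  "partial_recursive k f \<Longrightarrow> \<exists>g. stagewise k f g"
proof (induction rule: partial_recursive.induct)
  case pr_zero
  have "stagewise 0 (\<lambda>xs. Some 0) (\<lambda>ys. 1)"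
    unfolding stagewise_def by (auto intro: computable_const)
  then show ?case by blast
next
  case pr_succ
  have "computable 2 (\<lambda>ys. Suc (Suc (tl ys ! 0)))"
    unfolding numeral_2_eq_2 by (rule computable_intros | simp)+
  then have "stagewise 1 (\<lambda>xs. Some (Suc (xs ! 0))) (\<lambda>ys. Suc (Suc (tl ys ! 0)))"
    unfolding stagewise_def by (simp add: numeral_2_eq_2)
  then show ?case by blast
next
  case (pr_proj i k)
  have "computable (Suc k) (\<lambda>ys. Suc (tl ys ! i))"
    by (rule computable_intros pr_proj)+
  then have "stagewise k (\<lambda>xs. Some (xs ! i)) (\<lambda>ys. Suc (tl ys ! i))"
    unfolding stagewise_def by simp
  then show ?case by blast
next
  case (pr_comp gs f k)
  then obtain h F where "\<And>g. g \<in> set gs \<Longrightarrow> stagewise k g (h g)" "stagewise (length gs) f F"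
    by metis
  then show ?case
    using stagewise_comp by blast
next
  case (pr_prim k f g)
  then show ?case
    using stagewise_prim by blast
next
  case (pr_min k f)
  then show ?case
    using stagewise_min by blast
qed

section \<open>Strings and prefix-free sets\<close>

lemma nat_of_str_str_of_nat [simp]: "nat_of_str (str_of_nat n) = n"
  unfolding str_of_nat_def by (rule surj_f_inv_f[OF bij_is_surj[OF bij_nat_of_str]])

lemma str_of_nat_nat_of_str [simp]: "str_of_nat (nat_of_str s) = s"
  unfolding str_of_nat_def by (rule inv_f_f[OF bij_is_inj[OF bij_nat_of_str]])

text \<open>\<open>Suc (nat_of_str p)\<close> is the binary number \<open>1p\<close>. Appending
  \<open>r\<close> shifts it by \<open>length r\<close> bits and adds less than
  \<open>2 ^ length r\<close>, so extensions of \<open>p\<close> fill one dyadic block.\<close>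

lemma Suc_nat_of_str_append:
  "Suc (nat_of_str p) * 2 ^ length r \<le> Suc (nat_of_str (p @ r))"
  "Suc (nat_of_str (p @ r)) < Suc (Suc (nat_of_str p)) * 2 ^ length r"
proof (induction r rule: rev_induct)
  case (snoc c r)
  { case 1 then show ?case using snoc.IH(1) by (simp flip: append_assoc) }
  { case 2 then show ?case using snoc.IH(2) by (simp flip: append_assoc) }
qed auto

lemma Suc_nat_of_str_bounds:
  "2 ^ length p \<le> Suc (nat_of_str p)" "Suc (nat_of_str p) < 2 ^ Suc (length p)"
  using Suc_nat_of_str_append[of "[]" p] by auto

text \<open>Expresses a bound on the length through the code alone, in a form that is visibly
  decidable; \<open>count\<close> relies on it.\<close>

lemma length_le_iff_nat_of_str: "length p \<le> n \<longleftrightarrow> Suc (nat_of_str p) < 2 ^ Suc n"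
proof
  assume "length p \<le> n"
  then have "(2::nat) ^ Suc (length p) \<le> 2 ^ Suc n"
    by (intro power_increasing) auto
  then show "Suc (nat_of_str p) < 2 ^ Suc n"
    using Suc_nat_of_str_bounds(2)[of p] by linarith
next
  assume "Suc (nat_of_str p) < 2 ^ Suc n"
  then have "(2::nat) ^ length p < 2 ^ Suc n"
    using Suc_nat_of_str_bounds(1)[of p] by linarith
  then show "length p \<le> n"
    by (simp add: power_strict_increasing_iff del: power_Suc)
qed

lemma length_eqI_nat_of_str:
  assumes "2 ^ n \<le> Suc (nat_of_str p)" "Suc (nat_of_str p) < 2 ^ Suc n"
  shows "length p = n"
proof -
  have "\<not> length p \<le> n - 1" if "n > 0"
    using length_le_iff_nat_of_str[of p "n - 1"] assms(1) that by simp
  moreover have "length p \<le> n"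
    using length_le_iff_nat_of_str assms(2) by blast
  ultimately show ?thesis by (cases n) auto
qed

lemma real_two_power_diff:
  assumes "m \<le> n"
  shows "real (2 ^ (n - m)) = 2 ^ n * (1/2) ^ m"
proof -
  have "(2::real) ^ n = 2 ^ (n - m) * 2 ^ m"
    using assms by (simp flip: power_add)
  then show ?thesis by (simp add: power_one_over)
qed

text \<open>Extend all members to a common length \<open>N\<close>. The member \<open>p\<close> has
  \<open>2 ^ (N - length p)\<close> extensions, the sets of extensions are disjoint, and there are
  \<open>2 ^ N\<close> strings in total.\<close>

lemma kraft_inequality:
  assumes "finite F" "prefix_free F"
  shows "(\<Sum>p\<in>F. (1/2) ^ length p) \<le> (1::real)"
proof -
  obtain N where N: "\<And>p. p \<in> F \<Longrightarrow> length p \<le> N"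
    using finite_nat_set_iff_bounded_le[of "length ` F"] assms(1) by auto
  define ext where "ext p = {q :: str. length q = N \<and> prefix p q}" for p
  have card_all: "card {q :: str. length q = n} = 2 ^ n" for n
    using card_lists_length_eq[of "UNIV :: bool set" n] by simp
  have fin: "finite {q :: str. length q = n}" for n
    using finite_lists_length_eq[of "UNIV :: bool set" n] by simp
  have card_ext: "card (ext p) = 2 ^ (N - length p)" if "p \<in> F" for p
  proof -
    have "ext p = (@) p ` {r. length r = N - length p}"
      using N[OF that] unfolding ext_def by (auto simp: prefix_def image_iff)
    then show ?thesis
      by (simp add: card_image inj_on_def card_all)
  qed
  \<comment> \<open>Two prefixes of the same string are comparable.\<close>
  have disj: "ext p \<inter> ext q = {}" if "p \<in> F" "q \<in> F" "p \<noteq> q" for p q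
    using assms(2) that prefix_same_cases[of p _ q]
    unfolding ext_def prefix_free_def strict_prefix_def by blast
  have fe: "finite (ext p)" for p
    by (rule finite_subset[OF _ fin[of N]]) (auto simp: ext_def)
  have "(\<Sum>p\<in>F. 2 ^ (N - length p)) = (\<Sum>p\<in>F. card (ext p))"
    by (simp add: card_ext)
  also have "\<dots> = card (\<Union>p\<in>F. ext p)"
    using assms(1) fe disj by (intro card_UN_disjoint[symmetric]) auto
  also have "\<dots> \<le> card {q :: str. length q = N}"
    by (rule card_mono[OF fin]) (auto simp: ext_def)
  finally have "(\<Sum>p\<in>F. 2 ^ (N - length p)) \<le> (2::nat) ^ N"
    by (simp add: card_all)
  then have "real (\<Sum>p\<in>F. 2 ^ (N - length p)) \<le> real (2 ^ N)"
    by (rule of_nat_mono)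
  moreover have "real (\<Sum>p\<in>F. 2 ^ (N - length p)) = 2 ^ N * (\<Sum>p\<in>F. (1/2) ^ length p)"
    unfolding of_nat_sum sum_distrib_left
    by (intro sum.cong) (simp_all add: N real_two_power_diff del: of_nat_power)
  ultimately show ?thesis by simp
qed

section \<open>Machines from request streams\<close>

text \<open>Lets a function shown computable in one variable be used inside terms of any
  arity.\<close>

lemma computable_comp1:
  assumes "computable 1 (\<lambda>xs. G (xs ! 0))" "computable k F"
  shows "computable k (\<lambda>xs. G (F xs))"
  using computable_comp_list[OF assms(1)[unfolded One_nat_def]
      computable_list_cons[OF assms(2) computable_list_nil]] by simp

text \<open>Request \<open>i\<close>, active if \<open>E i\<close>, asks for a program of length about \<open>l i\<close> with output \<open>out i\<close>.
  The active requests partition an initial part of the unit interval into consecutive intervals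
  of lengths \<open>2 ^ - l i\<close>, and such an interval contains a dyadic interval of half its length,
  which is the cylinder of a string of length \<open>l i + 1\<close>.\<close>

lemma machine_of_requests:
  fixes E :: "nat \<Rightarrow> bool" and l out :: "nat \<Rightarrow> nat"
  assumes E: "decidable 1 (\<lambda>xs. E (xs ! 0))"
    and l: "computable 1 (\<lambda>xs. l (xs ! 0))"
    and out: "computable 1 (\<lambda>xs. out (xs ! 0))"
    and weight: "\<And>i. (\<Sum>j<i. of_bool (E j) * (1/2) ^ l j) \<le> (1::real)"
  shows "\<exists>D. prefix_free_machine D \<and>
    (\<forall>i. E i \<longrightarrow> (\<exists>q. length q = Suc (l i) \<and> D q = Some (str_of_nat (out i))))"
proof -
  define a :: "nat \<Rightarrow> real" where "a i = (\<Sum>j<i. of_bool (E j) * (1/2) ^ l j)" for i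
  \<comment> \<open>\<open>a i\<close> is the left end of interval \<open>i\<close>.
    \<open>M i\<close> is a common exponent for the earlier lengths, so \<open>a i\<close> is the
    fraction of \<open>N i\<close> and \<open>2 ^ M i\<close> and can be handled by natural number
    arithmetic.\<close>
  define M where "M i = (\<Sum>j<Suc i. l j)" for i
  define N :: "nat \<Rightarrow> nat" where "N i = (\<Sum>j<i. of_bool (E j) * 2 ^ (M i - l j))" for i
  \<comment> \<open>With \<open>x = a i * 2 ^ Suc (l i)\<close>, \<open>v i\<close> is the floor of
    \<open>x\<close> plus one, so \<open>x < v i\<close> and \<open>v i + 1 \<le> x + 2\<close>: the
    dyadic interval with index \<open>v i\<close> at level \<open>Suc (l i)\<close> lies inside
    interval \<open>i\<close>.\<close>
  define v where "v i = N i * 2 ^ Suc (l i) div 2 ^ M i + 1" for i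
  have a_eq: "a i = real (N i) / 2 ^ M i" for i
  proof -
    have "l j \<le> M i" if "j < i" for j
      unfolding M_def using that by (intro member_le_sum) auto
    then show ?thesis
      unfolding a_def N_def of_nat_sum sum_divide_distrib
      by (intro sum.cong) (simp_all add: real_two_power_diff del: of_nat_power)
  qed
  have v_floor: "real (v i) = of_int \<lfloor>real (N i * 2 ^ Suc (l i)) / real (2 ^ M i)\<rfloor> + 1" for i
    unfolding v_def floor_divide_of_nat_eq by simp
  have start: "a i \<le> v i / 2 ^ Suc (l i)" for i
  proof -
    have "real (N i * 2 ^ Suc (l i)) / real (2 ^ M i) \<le> real (v i)"
      unfolding v_floor by linarith
    then show ?thesis
      unfolding a_eq by (simp add: field_simps)
  qed
  have fin: "(v i + 1) / 2 ^ Suc (l i) \<le> a i + (1/2) ^ l i" for i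
  proof -
    have "real (v i) - 1 \<le> real (N i * 2 ^ Suc (l i)) / real (2 ^ M i)"
      unfolding v_floor by linarith
    then have "v i + 1 \<le> a i * 2 ^ Suc (l i) + 2"
      unfolding a_eq by simp
    then have "(v i + 1) / 2 ^ Suc (l i) \<le> (a i * 2 ^ Suc (l i) + 2) / 2 ^ Suc (l i)"
      by (intro divide_right_mono) auto
    also have "\<dots> = a i + (1/2) ^ l i"
      by (simp add: add_divide_distrib power_one_over)
    finally show ?thesis .
  qed
  have fin': "(v i + 1) / 2 ^ Suc (l i) \<le> a j" if "E i" "i < j" for i j
  proof -
    have "a i + (1/2) ^ l i = a (Suc i)"
      using that(1) by (simp add: a_def)
    also have "\<dots> \<le> a j"
      unfolding a_def using that(2) by (intro sum_mono2) auto
    finally show ?thesis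
      using fin[of i] by linarith
  qed
  \<comment> \<open>The interval ends at or before 1, so \<open>v i\<close> fits into
    \<open>Suc (l i)\<close> bits.\<close>
  have v_less: "v i < 2 ^ Suc (l i)" if "E i" for i
  proof -
    have "(v i + 1) / 2 ^ Suc (l i) \<le> 1"
      using fin'[OF that lessI] weight[of "Suc i"] unfolding a_def by (rule order_trans)
    then have "real (v i + 1) \<le> real (2 ^ Suc (l i))"
      by simp
    then show ?thesis
      unfolding of_nat_le_iff by simp
  qed
  have disjoint: "i = j"
    if "E i" "E j" "v i / 2 ^ Suc (l i) \<le> v j / 2 ^ Suc (l j)"
      "v j / 2 ^ Suc (l j) < (v i + 1) / 2 ^ Suc (l i)" for i j
  proof (cases i j rule: linorder_cases)
    case less
    then show ?thesis
      using fin'[OF that(1) less] start[of j] that(4) by linarith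
  next
    case greater
    have "v j / 2 ^ Suc (l j) < (v j + 1) / 2 ^ Suc (l j)"
      by (intro divide_strict_right_mono) auto
    then show ?thesis
      using fin'[OF that(2) greater] start[of i] that(3) by linarith
  qed

  \<comment> \<open>\<open>Suc x\<close> is the binary number with a leading 1 followed by
    \<open>v i\<close> in \<open>Suc (l i)\<close> bits; thus \<open>x\<close> is the code of the
    string assigned to request \<open>i\<close>.\<close>
  define R where "R i x \<longleftrightarrow> E i \<and> Suc x = 2 ^ Suc (l i) + v i" for i x
  have length_R: "length p = Suc (l i)" if "R i (nat_of_str p)" for i p
    by (rule length_eqI_nat_of_str) (use that v_less[of i] in \<open>auto simp: R_def\<close>)
  \<comment> \<open>The cylinder of \<open>p @ r\<close> starts inside that of \<open>p\<close>, so
    both belong to the same request. The case \<open>r = []\<close> shows that a string serves only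
    one request.\<close>
  have R_prefix: "i = j" if "R i (nat_of_str p)" "R j (nat_of_str (p @ r))" for i j p r
  proof -
    have L: "2 ^ Suc (l j) = 2 ^ Suc (l i) * (2 :: real) ^ length r"
      using length_R[OF that(1)] length_R[OF that(2)]
      by (metis length_append power_add)
    have "real ((2 ^ Suc (l i) + v i) * 2 ^ length r) \<le> real (2 ^ Suc (l j) + v j)"
      and "real (2 ^ Suc (l j) + v j) < real (Suc (2 ^ Suc (l i) + v i) * 2 ^ length r)"
      using Suc_nat_of_str_append[where p = p and r = r] that
      unfolding R_def of_nat_le_iff of_nat_less_iff by simp_all
    then have "real (v i) * 2 ^ length r \<le> real (v j)" "real (v j) < (real (v i) + 1) * 2 ^ length r"
      using L by (simp_all add: algebra_simps)
    then have "v i / 2 ^ Suc (l i) \<le> v j / 2 ^ Suc (l j)"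
      "v j / 2 ^ Suc (l j) < (v i + 1) / 2 ^ Suc (l i)"
      unfolding L by (simp_all add: divide_simps mult_ac add_ac)
    then show ?thesis
      using disjoint that unfolding R_def by blast
  qed

  have Ek: "decidable k (\<lambda>xs. E (F xs))" if "computable k F" for k F
    using computable_comp1[OF E[unfolded decidable_def] that] by (simp add: decidable_def)
  note lk = computable_comp1[OF l]
  have "computable 1 (\<lambda>xs. M (xs ! 0))"
    unfolding M_def One_nat_def by (rule computable_intros lk lessI)+
  note Mk = computable_comp1[OF this]
  have "computable 1 (\<lambda>xs. N (xs ! 0))"
    unfolding N_def One_nat_def by (rule computable_intros lk Mk Ek lessI)+
  note Nk = computable_comp1[OF this]
  have "computable 1 (\<lambda>xs. v (xs ! 0))"
    unfolding v_def One_nat_def by (rule computable_intros lk Mk Nk lessI)+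
  note vk = computable_comp1[OF this]
  have "computable (Suc (Suc 0)) (\<lambda>xs. of_bool (\<not> R (hd xs) (hd (tl xs))))"
    unfolding R_def by (rule computable_intros lk vk Ek)+
  then obtain \<phi> where \<phi>: "partial_recursive (Suc 1) \<phi>" "\<And>i x. \<phi> [i, x] = Some (of_bool (\<not> R i x))"
    unfolding computable_def by force
  \<comment> \<open>\<open>\<phi>\<close> vanishes exactly where \<open>R\<close> holds, so
    minimization finds the request served by \<open>p\<close> and diverges if there is none.\<close>
  define D where "D p = map_option (\<lambda>i. str_of_nat (out i)) (minimization \<phi> [nat_of_str p])" for p
  have min: "minimization \<phi> [x] = Some i \<longleftrightarrow> R i x \<and> (\<forall>m<i. \<not> R m x)" for x i
  proof -
    have "(\<exists>y. Some (of_bool (\<not> R m x)) = Some (Suc y)) \<longleftrightarrow> \<not> R m x" for m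
      by (cases "R m x") auto
    then show ?thesis
      unfolding minimization_eq_Some \<phi>(2) by simp
  qed
  have min_R: "minimization \<phi> [nat_of_str p] = Some i" if "R i (nat_of_str p)" for i p
  proof -
    have "m = i" if "R m (nat_of_str p)" for m
      using R_prefix[of m p i "[]"] that \<open>R i (nat_of_str p)\<close> by simp
    then show ?thesis
      unfolding min using that by blast
  qed
  obtain h where h: "partial_recursive 1 h" "\<And>x. h [x] = Some (out x)"
    using out unfolding computable_def by force
  have "partial_recursive 1 (\<lambda>xs. Option.bind (those (map (\<lambda>g. g xs) [minimization \<phi>])) h)"
    by (rule pr_comp) (use pr_min[OF \<phi>(1)] h(1) in auto)
  moreover have "map_option nat_of_str (D p) =
      Option.bind (those (map (\<lambda>g. g [nat_of_str p]) [minimization \<phi>])) h" for p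
    by (cases "minimization \<phi> [nat_of_str p]") (auto simp: D_def h(2))
  ultimately have "partial_recursive_str D"
    unfolding partial_recursive_str_def by blast
  moreover have "prefix_free (dom D)"
    unfolding prefix_free_def
  proof (intro ballI notI)
    fix p q
    assume "p \<in> dom D" "q \<in> dom D" "strict_prefix p q"
    then obtain i j r where ij: "R i (nat_of_str p)" "R j (nat_of_str q)" and q: "q = p @ r" "r \<noteq> []"
      unfolding D_def by (auto simp: dom_def min strict_prefix_def prefix_def)
    then have "length p = length q"
      using length_R R_prefix by metis
    with q show False by simp
  qed
  moreover have "\<exists>q. length q = Suc (l i) \<and> D q = Some (str_of_nat (out i))" if "E i" for i
  proof -
    define q where "q = str_of_nat (2 ^ Suc (l i) + v i - 1)"
    have "R i (nat_of_str q)"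
      using that by (simp add: R_def q_def)
    from length_R[OF this] min_R[OF this] show ?thesis
      unfolding D_def by (intro exI[of _ q]) simp
  qed
  ultimately show ?thesis
    unfolding prefix_free_machine_def by blast
qed

section \<open>Counting programs\<close>

lemma finite_exponents: "finite {k. 2 ^ k \<le> (m::nat)}"
proof (rule finite_subset)
  show "{k. 2 ^ k \<le> m} \<subseteq> {..m}"
    by (auto intro: less_imp_le[OF less_le_trans[OF less_exp]])
qed simp

text \<open>The geometric sum up to the largest admissible exponent \<open>k\<close> is at most
  \<open>2 * 2 ^ k\<close>, and \<open>2 ^ k \<le> m\<close>.\<close>

lemma sum_powers_of_2_le:
  "(\<Sum>k | 2 ^ k \<le> m. 2 ^ k) \<le> 2 * real m"
proof (cases "m = 0")
  case False
  let ?K = "{k. 2 ^ k \<le> m}"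
  note fin = finite_exponents[of m]
  define k where "k = Max ?K"
  have "0 \<in> ?K"
    using False by simp
  then have k: "2 ^ k \<le> m"
    using Max_in[OF fin] unfolding k_def by blast
  have "(\<Sum>k\<in>?K. 2 ^ k) \<le> (\<Sum>j\<le>k. 2 ^ j :: real)"
    using Max_ge[OF fin] unfolding k_def by (intro sum_mono2) auto
  also have "\<dots> \<le> 2 * 2 ^ k"
    by (induction k) auto
  also have "\<dots> \<le> 2 * real m"
    using k by (metis mult_left_mono of_nat_le_iff of_nat_numeral of_nat_power zero_le_numeral)
  finally show ?thesis .
qed simp

text \<open>The tail telescopes. It is applied with \<open>m\<close> the length of a program and
  \<open>n\<close> running over the length bounds under which that program is counted.\<close>

lemma geometric_tail_le:
  "(\<Sum>n\<le>i. of_bool (m \<le> n) * (1/2) ^ Suc n) \<le> ((1/2) ^ m :: real)"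
proof -
  have "(\<Sum>n\<le>i. of_bool (m \<le> n) * (1/2) ^ Suc n) =
      (if m \<le> i then (1/2) ^ m - (1/2) ^ Suc i else 0 :: real)"
    by (induction i) (auto simp: le_Suc_eq)
  then show ?thesis by simp
qed

section \<open>Counting programs in stages and the requests derived from the counts\<close>

locale staged_machine =
  fixes C :: "str \<rightharpoonup> str" and f :: "nat list \<rightharpoonup> nat" and g :: "nat list \<Rightarrow> nat"
  assumes prefix_free_C: "prefix_free (dom C)"
    and f: "map_option nat_of_str (C p) = f [nat_of_str p]"
    and g: "stagewise 1 f g"
begin

text \<open>Searching all earlier stages makes the relation monotone in \<open>t\<close>, which
  \<open>stagewise\<close> does not demand of \<open>g\<close> itself.\<close>

definition converges :: "nat \<Rightarrow> nat \<Rightarrow> nat \<Rightarrow> bool" where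
  "converges t p s \<longleftrightarrow> (\<exists>u<t. g [u, p] = Suc s)"

text \<open>The first conjunct says that the string coded by \<open>p\<close> has length at most
  \<open>n\<close>; letting \<open>t\<close> bound \<open>p\<close> as well keeps the sum finite and
  monotone in \<open>t\<close>.\<close>

definition count :: "nat \<Rightarrow> nat \<Rightarrow> nat \<Rightarrow> nat" where
  "count t n s = (\<Sum>p<t. of_bool (Suc p < 2 ^ Suc n \<and> converges t p s))"

lemma converges_imp_C: "converges t p s \<Longrightarrow> C (str_of_nat p) = Some (str_of_nat s)"
proof -
  assume "converges t p s"
  then have "f [p] = Some s"
    using stagewiseD(1)[OF g] by (auto simp: converges_def)
  then show ?thesis
    using f[of "str_of_nat p"] by auto
qed

lemma eventually_converges:
  assumes "C p = Some s"
  shows "\<forall>\<^sub>F t in sequentially. converges t (nat_of_str p) (nat_of_str s)"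
proof -
  have "f [nat_of_str p] = Some (nat_of_str s)"
    using f[of p] assms by simp
  then have "\<forall>\<^sub>F t in sequentially. g [t, nat_of_str p] = Suc (nat_of_str s)"
    using stagewiseD(2)[OF g] by simp
  then obtain u where "g [u, nat_of_str p] = Suc (nat_of_str s)"
    by (meson eventually_sequentially order_refl)
  then show ?thesis
    unfolding converges_def
    by (intro eventually_mono[OF eventually_gt_at_top[of u]]) blast
qed

lemma count_eq_card: "count t n s = card {p. p < t \<and> Suc p < 2 ^ Suc n \<and> converges t p s}"
proof -
  have "{p. p < t \<and> Suc p < 2 ^ Suc n \<and> converges t p s} =
      {..<t} \<inter> {p. Suc p < 2 ^ Suc n \<and> converges t p s}"
    by auto
  then show ?thesis
    unfolding count_def by simp
qed

lemma count_mono: "t \<le> t' \<Longrightarrow> count t n s \<le> count t' n s"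
  unfolding count_eq_card converges_def
  by (intro card_mono) (auto intro: less_le_trans)

text \<open>There are \<open>2 ^ Suc n - 1\<close> strings of length at most \<open>n\<close>. This
  keeps the exponents of active requests at most \<open>n\<close>.\<close>

lemma count_less: "count t n s < 2 ^ Suc n"
proof -
  have "count t n s \<le> card {..<2 ^ Suc n - 1 :: nat}"
    unfolding count_eq_card by (intro card_mono) auto
  also have "\<dots> < 2 ^ Suc n"
    by (simp del: power_Suc)
  finally show ?thesis .
qed

text \<open>The set of programs is finite, so a single stage suffices to know all of them.\<close>

lemma eventually_count:
  "\<forall>\<^sub>F t in sequentially. card (programs C n s) \<le> count t n (nat_of_str s)"
proof -
  have "\<forall>\<^sub>F t in sequentially. \<forall>p\<in>programs C n s.
      nat_of_str p < t \<and> converges t (nat_of_str p) (nat_of_str s)"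
    using eventually_converges
    by (intro eventually_ball_finite finite_programs ballI eventually_conj eventually_gt_at_top)
       (auto simp: programs_def)
  then show ?thesis
  proof eventually_elim
    case (elim t)
    have "card (programs C n s) = card (nat_of_str ` programs C n s)"
      by (intro card_image[symmetric] inj_on_subset[OF bij_is_inj[OF bij_nat_of_str]]) auto
    also have "\<dots> \<le> count t n (nat_of_str s)"
      unfolding count_eq_card
    proof (rule card_mono)
      show "nat_of_str ` programs C n s \<subseteq>
          {p. p < t \<and> Suc p < 2 ^ Suc n \<and> converges t p (nat_of_str s)}"
        using elim length_le_iff_nat_of_str[of _ n] by (auto simp: programs_def)
    qed simp
    finally show ?case .
  qed
qed

text \<open>A number codes a request as \<open>((n, s), (k, t))\<close> by iterated pairing, where
  \<open>t\<close> is the stage just before the threshold \<open>2 ^ k\<close> is reached.\<close>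

definition req_n where "req_n i = fst (prod_decode (fst (prod_decode i)))"
definition req_s where "req_s i = snd (prod_decode (fst (prod_decode i)))"
definition req_k where "req_k i = fst (prod_decode (snd (prod_decode i)))"
definition req_t where "req_t i = snd (prod_decode (snd (prod_decode i)))"

text \<open>A request for the pair \<open>(n, s)\<close> becomes active at the stage where the number of known
  programs reaches \<open>2 ^ k\<close>.\<close>

definition active :: "nat \<Rightarrow> bool" where
  "active i \<longleftrightarrow> count (req_t i) (req_n i) (req_s i) < 2 ^ req_k i \<and>
     2 ^ req_k i \<le> count (Suc (req_t i)) (req_n i) (req_s i)"

text \<open>The 2 pays for two geometric sums, one over the thresholds \<open>k\<close> and one over
  the bounds \<open>n \<ge> length p\<close>. On active requests the subtraction is exact by
  \<open>active_k_le\<close>.\<close>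

definition req_length :: "nat \<Rightarrow> nat" where
  "req_length i = req_n i + 2 - req_k i"

lemma fst_prod_decode_le: "fst (prod_decode i) \<le> i"
  by (metis le_prod_encode_1 prod.collapse prod_decode_inverse)

lemma snd_prod_decode_le: "snd (prod_decode i) \<le> i"
  by (metis le_prod_encode_2 prod.collapse prod_decode_inverse)

text \<open>Confines the parameters of all requests below \<open>i\<close> to a finite box, over
  which the weights can be summed.\<close>

lemma req_le: "req_n i \<le> i" "req_s i \<le> i" "req_k i \<le> i" "req_t i \<le> i"
  unfolding req_n_def req_s_def req_k_def req_t_def
  by (rule order_trans[OF fst_prod_decode_le fst_prod_decode_le]
      order_trans[OF snd_prod_decode_le fst_prod_decode_le]
      order_trans[OF fst_prod_decode_le snd_prod_decode_le]
      order_trans[OF snd_prod_decode_le snd_prod_decode_le])+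

lemma computable_req [computable_intros]:
  assumes "computable k F"
  shows "computable k (\<lambda>xs. req_n (F xs))" "computable k (\<lambda>xs. req_s (F xs))"
    "computable k (\<lambda>xs. req_k (F xs))" "computable k (\<lambda>xs. req_t (F xs))"
  unfolding req_n_def req_s_def req_k_def req_t_def by (rule computable_intros assms)+

lemma req_eqD:
  "req_n i = req_n j \<Longrightarrow> req_s i = req_s j \<Longrightarrow> req_k i = req_k j \<Longrightarrow> req_t i = req_t j \<Longrightarrow> i = j"
  unfolding req_n_def req_s_def req_k_def req_t_def
  by (metis prod.expand prod_decode_eq)

lemma req_exists: "\<exists>i. req_n i = n \<and> req_s i = s \<and> req_k i = k \<and> req_t i = t"
  by (rule exI[of _ "prod_encode (prod_encode (n, s), prod_encode (k, t))"])
     (simp add: req_n_def req_s_def req_k_def req_t_def)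

lemma active_k_le: "active i \<Longrightarrow> req_k i \<le> req_n i"
proof -
  assume "active i"
  then have "(2::nat) ^ req_k i < 2 ^ Suc (req_n i)"
    using count_less unfolding active_def by (meson le_less_trans)
  then show ?thesis
    by (simp add: power_strict_increasing_iff del: power_Suc)
qed

text \<open>The count is monotone in the stage, so it crosses a given threshold only once.\<close>

lemma active_unique:
  assumes "active i" "active j" "req_n i = req_n j" "req_s i = req_s j" "req_k i = req_k j"
  shows "i = j"
proof -
  have "\<not> req_t i < req_t j"
    using assms count_mono[of "Suc (req_t i)" "req_t j" "req_n j" "req_s j"]
    unfolding active_def by (auto simp: Suc_le_eq)
  moreover have "\<not> req_t j < req_t i"
    using assms count_mono[of "Suc (req_t j)" "req_t i" "req_n j" "req_s j"]
    unfolding active_def by (auto simp: Suc_le_eq)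
  ultimately show ?thesis
    using assms by (auto intro: req_eqD[OF assms(3-5)])
qed

lemma decidable_active: "decidable 1 (\<lambda>xs. active (xs ! 0))"
proof -
  have gc: "computable (Suc (Suc 0)) g"
    using g unfolding stagewise_def by simp
  show ?thesis
    unfolding active_def count_def converges_def One_nat_def
    by (rule computable_intros computable_comp_list[OF gc] lessI)+
qed

lemma computable_req_length: "computable 1 (\<lambda>xs. req_length (xs ! 0))"
  unfolding req_length_def One_nat_def by (rule computable_intros lessI)+

text \<open>The thresholds \<open>2 ^ k \<le> count i n s\<close> contribute at most twice the count, and every program
  \<open>p\<close> is counted for the lengths \<open>n \<ge> length p\<close>, so the weight reduces to the Kraft sum of \<open>C\<close>.\<close>

lemma sum_active_le: "(\<Sum>j<i. of_bool (active j) * (1/2) ^ req_length j) \<le> (1::real)"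
proof -
  define J where "J = {j. j < i \<and> active j}"
  define \<kappa> where "\<kappa> j = (req_n j, req_s j, req_k j)" for j
  define w :: "nat \<times> nat \<times> nat \<Rightarrow> real" where "w = (\<lambda>(n, s, k). 2 ^ k * (1/2) ^ (n + 2))"
  define B where "B = (SIGMA n:{..i}. SIGMA s:{..i}. {k. 2 ^ k \<le> count i n s})"
  have fin_B: "finite B"
    unfolding B_def by (intro finite_SigmaI finite_exponents finite_atMost)
  have w: "(1/2) ^ req_length j = w (\<kappa> j)" if "active j" for j
    using active_k_le[OF that] unfolding w_def \<kappa>_def req_length_def
    by (simp add: power_diff power_one_over)
  have "inj_on \<kappa> J"
    unfolding inj_on_def J_def \<kappa>_def using active_unique by auto
  have "\<kappa> ` J \<subseteq> B"
  proof
    fix x assume "x \<in> \<kappa> ` J"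
    then obtain j where j: "j < i" "active j" "x = \<kappa> j"
      unfolding J_def by auto
    \<comment> \<open>Since \<open>req_t j \<le> j < i\<close>, the threshold has been reached by
      stage \<open>i\<close>.\<close>
    have "2 ^ req_k j \<le> count i (req_n j) (req_s j)"
      using j(1,2) req_le(4)[of j] count_mono[of "Suc (req_t j)" i "req_n j" "req_s j"]
      unfolding active_def by linarith
    then show "x \<in> B"
      using j req_le[of j] unfolding B_def \<kappa>_def by auto
  qed
  have "(\<Sum>j<i. of_bool (active j) * (1/2) ^ req_length j) = (\<Sum>j\<in>J. (1/2::real) ^ req_length j)"
    unfolding J_def by (intro sum.mono_neutral_cong_right) auto
  also have "\<dots> = (\<Sum>j\<in>J. w (\<kappa> j))"
    by (intro sum.cong) (auto simp: J_def w)
  also have "\<dots> = sum w (\<kappa> ` J)"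
    by (rule sum.reindex_cong[symmetric, OF \<open>inj_on \<kappa> J\<close>]) auto
  also have "\<dots> \<le> sum w B"
    using fin_B \<open>\<kappa> ` J \<subseteq> B\<close> by (intro sum_mono2) (auto simp: w_def)
  also have "\<dots> = (\<Sum>n\<le>i. \<Sum>s\<le>i. \<Sum>k | 2 ^ k \<le> count i n s. 2 ^ k * (1/2) ^ (n + 2))"
    unfolding B_def w_def by (simp add: sum.Sigma finite_exponents)
  also have "\<dots> \<le> (\<Sum>n\<le>i. \<Sum>s\<le>i. count i n s * (1/2) ^ Suc n)"
  proof (intro sum_mono)
    fix n s
    have "(\<Sum>k | 2 ^ k \<le> count i n s. 2 ^ k * (1/2::real) ^ (n + 2)) \<le>
        2 * real (count i n s) * (1/2) ^ (n + 2)"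
      unfolding sum_distrib_right[symmetric]
      by (intro mult_right_mono sum_powers_of_2_le) simp
    then show "(\<Sum>k | 2 ^ k \<le> count i n s. 2 ^ k * (1/2) ^ (n + 2)) \<le> count i n s * (1/2) ^ Suc n"
      by simp
  qed
  also have "\<dots> = (\<Sum>n\<le>i. \<Sum>s\<le>i. \<Sum>p<i.
      of_bool (Suc p < 2 ^ Suc n) * (1/2) ^ Suc n * of_bool (converges i p s))"
    unfolding count_def of_nat_sum sum_distrib_right
    by (intro sum.cong refl) (simp add: of_bool_conj)
  \<comment> \<open>With \<open>p\<close> outermost, the summand splits into a factor in
    \<open>n\<close>, bounded by the geometric tail, and a factor in \<open>s\<close>, bounded by 1
    because \<open>C\<close> gives \<open>p\<close> at most one output.\<close>
  also have "\<dots> = (\<Sum>p<i. \<Sum>n\<le>i. \<Sum>s\<le>i.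
      of_bool (Suc p < 2 ^ Suc n) * (1/2) ^ Suc n * of_bool (converges i p s))"
    by (subst sum.swap[of _ "{..<i}"], subst sum.swap[of _ "{..<i}"], rule refl)
  also have "\<dots> = (\<Sum>p<i. (\<Sum>n\<le>i. of_bool (Suc p < 2 ^ Suc n) * (1/2) ^ Suc n) *
      (\<Sum>s\<le>i. of_bool (converges i p s)))"
    by (simp only: sum_product)
  also have "\<dots> \<le> (\<Sum>p<i. (1/2) ^ length (str_of_nat p) * of_bool (str_of_nat p \<in> dom C))"
  proof (intro sum_mono mult_mono sum_nonneg)
    fix p
    show "(\<Sum>n\<le>i. of_bool (Suc p < 2 ^ Suc n) * (1/2) ^ Suc n) \<le> (1/2 :: real) ^ length (str_of_nat p)"
      using geometric_tail_le[of "length (str_of_nat p)" i]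
      unfolding length_le_iff_nat_of_str by simp
    show "(\<Sum>s\<le>i. of_bool (converges i p s)) \<le> (of_bool (str_of_nat p \<in> dom C) :: real)"
    proof (cases "C (str_of_nat p)")
      case None
      then have "\<not> converges i p s" for s
        using converges_imp_C by fastforce
      then show ?thesis by simp
    next
      case (Some y)
      have "s = nat_of_str y" if "converges i p s" for s
        using converges_imp_C[OF that] Some by auto
      then have "(\<Sum>s\<le>i. of_bool (converges i p s)) \<le> (\<Sum>s\<le>i. of_bool (s = nat_of_str y) :: real)"
        by (intro sum_mono) auto
      also have "\<dots> \<le> 1"
        by (simp add: of_bool_def sum.delta)
      finally show ?thesis
        using Some by (simp add: domI)
    qed
  qed auto
  also have "\<dots> = (\<Sum>p\<in>str_of_nat ` {..<i} \<inter> dom C. (1/2) ^ length p)"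
  proof -
    have "inj_on str_of_nat {..<i}"
      by (metis inj_onI nat_of_str_str_of_nat)
    then show ?thesis
      by (subst sum.inter_restrict) (simp_all add: sum.reindex of_bool_def if_distrib cong: if_cong)
  qed
  also have "\<dots> \<le> 1"
    using prefix_free_C by (intro kraft_inequality) (auto simp: prefix_free_def)
  finally show ?thesis .
qed

end

section \<open>Reading the bound off the optimality of \<open>U\<close>\<close>

theorem theorem11:
  fixes U C :: "str \<rightharpoonup> str" and b :: "str \<times> str \<Rightarrow> str"
  assumes "optimal U"
    and "bij b" and "total_recursive_str2 b"
    and "prefix_free_machine C"
  shows "\<exists>d::nat. \<forall>(n::nat) (s::str).
    real (card (programs C n s))
      \<le> 2 powr (real n - real (the_enat (joint_complexity U b (str_of_nat n) s)) + real d)"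
proof -
  obtain f where f: "partial_recursive 1 f" "\<And>p. map_option nat_of_str (C p) = f [nat_of_str p]"
    and C: "prefix_free (dom C)"
    using assms(4) unfolding prefix_free_machine_def partial_recursive_str_def by blast
  obtain g where g: "stagewise 1 f g"
    using partial_recursive_stagewise[OF f(1)] by blast
  interpret staged_machine C f g
    by unfold_locales (fact C f(2) g)+
  define out where "out i = nat_of_str (b (str_of_nat (req_n i), str_of_nat (req_s i)))" for i
  obtain h where h: "partial_recursive 2 h"
    "\<And>s t. h [nat_of_str s, nat_of_str t] = Some (nat_of_str (b (s, t)))"
    using assms(3) unfolding total_recursive_str2_def by blast
  have out: "computable 1 (\<lambda>xs. out (xs ! 0))"
  proof -
    have "h [m, n] = Some (nat_of_str (b (str_of_nat m, str_of_nat n)))" for m n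
      using h(2)[of "str_of_nat m" "str_of_nat n"] by simp
    then have "computable 2 (\<lambda>xs. nat_of_str (b (str_of_nat (xs ! 0), str_of_nat (xs ! 1))))"
      unfolding computable_def using h(1)
      by (intro exI[of _ h]) (auto simp: numeral_2_eq_2 length_Suc_conv)
    moreover have "computable_list 1 2 (\<lambda>xs. [req_n (xs ! 0), req_s (xs ! 0)])"
      unfolding numeral_2_eq_2 One_nat_def by (rule computable_intros lessI)+
    ultimately show ?thesis
      unfolding out_def using computable_comp_list by fastforce
  qed
  obtain D where D: "prefix_free_machine D"
    "\<And>i. active i \<Longrightarrow> \<exists>q. length q = Suc (req_length i) \<and> D q = Some (str_of_nat (out i))"
    using machine_of_requests[OF decidable_active computable_req_length out sum_active_le] by blast
  obtain d where d: "\<And>s. complexity U s \<le> complexity D s + enat d"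
    using assms(1) D(1) unfolding optimal_def by blast
  \<comment> \<open>Of the 4, two come from \<open>req_length\<close>, one from the extra bit of
    \<open>D\<close>, and one from rounding the number of programs up to
    \<open>2 ^ Suc k\<close>.\<close>
  have "real (card (programs C n s))
      \<le> 2 powr (real n - real (the_enat (joint_complexity U b (str_of_nat n) s)) + real (d + 4))"
    for n s
  proof (cases "card (programs C n s) = 0")
    case False
    \<comment> \<open>The largest threshold is used; it asks for the shortest program.\<close>
    obtain k where k: "2 ^ k \<le> card (programs C n s)" "card (programs C n s) < 2 ^ Suc k"
      using ex_power_ivl1[of 2 "card (programs C n s)"] False by auto
    define P where "P t \<longleftrightarrow> 2 ^ k \<le> count t n (nat_of_str s)" for t
    have "\<exists>t. P t"
      using eventually_count[of n s] k(1) unfolding P_def eventually_sequentially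
      by (meson order_refl order_trans)
    moreover have "\<not> P 0"
      by (simp add: P_def count_def)
    \<comment> \<open>The count starts at 0 and eventually reaches \<open>2 ^ k\<close>, so there is
      a stage at which the request becomes active.\<close>
    ultimately obtain t where t: "\<not> P t" "P (Suc t)"
      using ex_least_nat_less[of P] by (metis Suc_eq_plus1 order_refl)
    obtain i where i: "req_n i = n" "req_s i = nat_of_str s" "req_k i = k" "req_t i = t"
      using req_exists by blast
    then have act: "active i"
      using t unfolding active_def P_def by simp
    obtain q where q: "length q = Suc (req_length i)" "D q = Some (b (str_of_nat n, s))"
      using D(2)[OF act] i by (auto simp: out_def)
    have kn: "k \<le> n"
      using active_k_le[OF act] i by simp
    have "complexity D (b (str_of_nat n, s)) \<le> enat (length q)"
      unfolding complexity_def using q(2) by (intro INF_lower) simp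
    also have "length q = n + 3 - k"
      using q(1) i kn by (simp add: req_length_def)
    finally have "joint_complexity U b (str_of_nat n) s \<le> enat (n + 3 - k) + enat d"
      using d[of "b (str_of_nat n, s)"] unfolding joint_complexity_def
      by (meson add_right_mono order_trans)
    \<comment> \<open>The upper bound makes the complexity finite, so \<open>the_enat\<close>
      returns its actual value.\<close>
    then have "the_enat (joint_complexity U b (str_of_nat n) s) \<le> n + 3 - k + d"
      by (cases "joint_complexity U b (str_of_nat n) s") auto
    then have H: "real (Suc k) \<le>
        real n - real (the_enat (joint_complexity U b (str_of_nat n) s)) + real (d + 4)"
      using kn by linarith
    have "real (card (programs C n s)) \<le> 2 ^ Suc k"
      using k(2) by (metis less_imp_le of_nat_le_iff of_nat_numeral of_nat_power)
    also have "\<dots> = 2 powr real (Suc k)"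
      by (rule powr_realpow[symmetric]) simp
    also have "\<dots> \<le> 2 powr (real n - real (the_enat (joint_complexity U b (str_of_nat n) s)) + real (d + 4))"
      using H by (intro powr_mono) auto
    finally show ?thesis .
  qed simp
  then show ?thesis by blast
qed

end
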